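(* Let $M$ be a bounded, connected, embedded complex submanifold of $\mathbb{C}^d$. For any $z,w\in M$ and any $\kappa>0$, there exists a $(1,\kappa)$-almost-geodesic $\sigma:[a,b]\to M$ such that $\sigma(a)=z$ and $\sigma(b)=w$.
   Context: $\mathbb{D}$ is the open unit disk in $\mathbb{C}$. $\mathsf{k}_M$ is the Kobayashi distance and $\kappa_M(z;v)=\inf\{t>0:\exists\,\phi:\mathbb{D}\to M \text{ holomorphic},\ \phi(0)=z,\ t\phi'(0)=v\}$ ($z\in M$, $v\in T^{(1,0)}_zM$) is the Kobayashi--Royden metric of $M$. For $\kappa\ge0$ and an interval $I\subset\mathbb{R}$, a $(1,\kappa)$-almost-geodesic is an absolutely continuous curve $\sigma:I\to M$ such that $|t-s|-\kappa\leq\mathsf{k}_M(\sigma(t),\sigma(s))\leq|t-s|+\kappa$ for all $s,t\in I$ and $\kappa_M(\sigma(t);\sigma'(t))\leq1$ for almost every $t\in I$. *)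

theory Defs
  imports "HOL-Analysis.Analysis"
begin

text \<open>Holomorphic maps of several variables: real Frechet derivative at every point, complex linear.
  Only used for open \<^term>\<open>U\<close>.\<close>

definition holomorphic_map_on :: "(complex^'m \<Rightarrow> complex^'n) \<Rightarrow> (complex^'m) set \<Rightarrow> bool" where
  "holomorphic_map_on f U \<longleftrightarrow>
     (\<forall>x\<in>U. \<exists>f'. (f has_derivative f') (at x) \<and> Vector_Spaces.linear (*s) (*s) f')"

text \<open>Embedded complex submanifolds of complex dimension \<^term>\<open>k\<close>, given by slice charts: near each
  of its points, \<^term>\<open>M\<close> is carried to a \<^term>\<open>k\<close>-dimensional coordinate plane by a biholomorphism
  \<^term>\<open>\<Phi>\<close> (with inverse \<^term>\<open>\<Psi>\<close>) between open subsets of the ambient space.\<close>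

definition embedded_complex_submanifold :: "nat \<Rightarrow> (complex^'d) set \<Rightarrow> bool" where
  "embedded_complex_submanifold k M \<longleftrightarrow>
     (\<forall>p\<in>M. \<exists>U V (\<Phi> :: complex^'d \<Rightarrow> complex^'d) \<Psi> J.
        open U \<and> open V \<and> p \<in> U \<and> homeomorphism U V \<Phi> \<Psi> \<and>
        holomorphic_map_on \<Phi> U \<and> holomorphic_map_on \<Psi> V \<and>
        card J = k \<and> \<Phi> ` (U \<inter> M) = {y \<in> V. \<forall>i. i \<notin> J \<longrightarrow> y $ i = 0})"

text \<open>Since \<^term>\<open>M\<close> is embedded, a map from the disc to \<^term>\<open>M\<close> is holomorphic iff it is
  holomorphic as a map to the ambient space.\<close>

definition holomorphic_discs :: "(complex^'d) set \<Rightarrow> (complex \<Rightarrow> complex^'d) set" where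
  "holomorphic_discs M =
     {\<phi>. (\<forall>i. (\<lambda>\<zeta>. \<phi> \<zeta> $ i) holomorphic_on ball 0 1) \<and> \<phi> ` ball 0 1 \<subseteq> M}"

definition disc_deriv :: "(complex \<Rightarrow> complex^'d) \<Rightarrow> complex \<Rightarrow> complex^'d" where
  "disc_deriv \<phi> \<zeta> = (\<chi> i. deriv (\<lambda>\<xi>. \<phi> \<xi> $ i) \<zeta>)"

text \<open>The Poincare distance, normalised so that its infinitesimal form is
  \<open>\<bar>v\<bar> / (1 - \<bar>\<zeta>\<bar>\<^sup>2)\<close>, which is the Kobayashi--Royden metric of the disc.\<close>

definition poincare_dist :: "complex \<Rightarrow> complex \<Rightarrow> real" where
  "poincare_dist a b = artanh (norm ((a - b) / (1 - cnj b * a)))"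

text \<open>Kobayashi's definition by chains of discs. The infimum is taken in \<^typ>\<open>ereal\<close>, so it is
  infinite if no chain joins the two points.\<close>

definition kobayashi_dist :: "(complex^'d) set \<Rightarrow> complex^'d \<Rightarrow> complex^'d \<Rightarrow> ereal" where
  "kobayashi_dist M z w =
     Inf {ereal (\<Sum>j<n. poincare_dist (a j) (b j)) | (n::nat) p \<phi> a b.
            p 0 = z \<and> p n = w \<and>
            (\<forall>j<n. \<phi> j \<in> holomorphic_discs M \<and> a j \<in> ball 0 1 \<and> b j \<in> ball 0 1 \<and>
                   \<phi> j (a j) = p j \<and> \<phi> j (b j) = p (Suc j))}"

text \<open>Tangent vectors of \<^term>\<open>M\<close> are regarded as vectors of the ambient space. If \<^term>\<open>v\<close> is not
  tangent to \<^term>\<open>M\<close> at \<^term>\<open>z\<close>, the set below is empty and the value is infinite.\<close>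

definition kobayashi_royden :: "(complex^'d) set \<Rightarrow> complex^'d \<Rightarrow> complex^'d \<Rightarrow> ereal" where
  "kobayashi_royden M z v =
     Inf {ereal t | t. 0 < t \<and> (\<exists>\<phi>\<in>holomorphic_discs M. \<phi> 0 = z \<and> t *\<^sub>R disc_deriv \<phi> 0 = v)}"

definition absolutely_continuous_curve :: "real set \<Rightarrow> (real \<Rightarrow> 'a::real_normed_vector) \<Rightarrow> bool" where
  "absolutely_continuous_curve I \<sigma> \<longleftrightarrow>
     (\<forall>\<epsilon>>0. \<exists>\<delta>>0. \<forall>(n::nat) s t.
        (\<forall>j<n. s j \<le> t j \<and> {s j..t j} \<subseteq> I) \<and>
        disjoint_family_on (\<lambda>j. {s j<..<t j}) {..<n} \<and>
        (\<Sum>j<n. t j - s j) < \<delta>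
        \<longrightarrow> (\<Sum>j<n. norm (\<sigma> (t j) - \<sigma> (s j))) < \<epsilon>)"

definition almost_geodesic ::
    "(complex^'d) set \<Rightarrow> real \<Rightarrow> real set \<Rightarrow> (real \<Rightarrow> complex^'d) \<Rightarrow> bool" where
  "almost_geodesic M \<kappa> I \<sigma> \<longleftrightarrow>
     is_interval I \<and> \<sigma> ` I \<subseteq> M \<and> absolutely_continuous_curve I \<sigma> \<and>
     (\<forall>s\<in>I. \<forall>t\<in>I. ereal (\<bar>t - s\<bar> - \<kappa>) \<le> kobayashi_dist M (\<sigma> t) (\<sigma> s) \<and>
                   kobayashi_dist M (\<sigma> t) (\<sigma> s) \<le> ereal (\<bar>t - s\<bar> + \<kappa>)) \<and>
     (AE t in lebesgue. t \<in> I \<longrightarrow>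
        \<sigma> differentiable (at t within I) \<and>
        kobayashi_royden M (\<sigma> t) (vector_derivative \<sigma> (at t within I)) \<le> 1)"

end

theory Submission
  imports Defs "HOL-Complex_Analysis.Riemann_Mapping"
begin

text \<open>Join \<open>z\<close> to \<open>w\<close> by a chain of discs whose total length \<open>L\<close> exceeds the Kobayashi distance by less
  than \<open>\<kappa>\<close>; such chains exist because chain-connected components are open. Concatenating the images
  of the unit speed Poincare geodesics of the discs gives a piecewise smooth curve \<open>\<sigma>\<close> on \<open>[0, L]\<close>
  of Kobayashi--Royden speed at most one, in which every sub-arc is again a chain of length
  \<open>\<bar>t - s\<bar>\<close>. A chain from \<open>\<sigma> s\<close> to \<open>\<sigma> t\<close> shorter than \<open>\<bar>t - s\<bar> - \<kappa>\<close> would, together with the two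
  remaining arcs, give a chain from \<open>z\<close> to \<open>w\<close> shorter than the distance.\<close>

subsection \<open>Chains of discs\<close>

text \<open>The length is a real index, so lengths add under concatenation and facts about chains
  follow by rule induction. The empty chain is allowed at every point, even one outside
  \<open>M\<close>.\<close>

inductive disc_chain :: "(complex^'d) set \<Rightarrow> real \<Rightarrow> complex^'d \<Rightarrow> complex^'d \<Rightarrow> bool" for M where
  disc_chain_refl: "disc_chain M 0 x x"
| disc_chain_step: "disc_chain M l x y \<Longrightarrow> \<phi> \<in> holomorphic_discs M \<Longrightarrow> a \<in> ball 0 1 \<Longrightarrow> b \<in> ball 0 1
     \<Longrightarrow> \<phi> a = y \<Longrightarrow> \<phi> b = w \<Longrightarrow> disc_chain M (l + poincare_dist a b) x w"

lemma disc_chain_single: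
  assumes "\<phi> \<in> holomorphic_discs M" "a \<in> ball 0 1" "b \<in> ball 0 1"
  shows "disc_chain M (poincare_dist a b) (\<phi> a) (\<phi> b)"
  using disc_chain_step[OF disc_chain_refl assms refl refl] by simp

text \<open>The chain to be appended comes first because the induction runs over it, and chains grow
  at their end.\<close>

lemma disc_chain_trans:
  assumes "disc_chain M l' y w" "disc_chain M l x y"
  shows "disc_chain M (l + l') x w"
  using assms
  by (induction) (auto simp: add.assoc[symmetric] intro: disc_chain_step)

text \<open>The two denominators are complex conjugates of each other.\<close>

lemma poincare_dist_commute: "poincare_dist a b = poincare_dist b a"
proof -
  have "norm (1 - cnj b * a) = norm (1 - cnj a * b)"
    by (metis complex_cnj_cnj complex_cnj_diff complex_cnj_mult complex_cnj_one complex_mod_cnj mult.commute)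
  then show ?thesis
    by (simp add: poincare_dist_def norm_divide norm_minus_commute)
qed

lemma disc_chain_sym:
  assumes "disc_chain M l x y"
  shows "disc_chain M l y x"
  using assms
proof induction
  case (disc_chain_step l x y \<phi> a b w)
  then have "disc_chain M (poincare_dist a b) w y"
    using disc_chain_single poincare_dist_commute by metis
  from disc_chain_trans[OF disc_chain_step.IH this] show ?case
    by (simp add: add.commute)
qed (rule disc_chain_refl)

lemma artanh_nonneg:
  fixes r :: real
  assumes "0 \<le> r" "r < 1"
  shows "0 \<le> artanh r"
  using assms by (simp add: artanh_def field_simps)

lemma tanh_artanh:
  fixes r :: real
  assumes "\<bar>r\<bar> < 1"
  shows "tanh (artanh r) = r"
proof -
  have "exp (- ln ((1 + r) / (1 - r))) = (1 - r) / (1 + r)"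
    using assms by (simp add: exp_minus)
  then have "tanh (artanh r) = (1 - (1 - r) / (1 + r)) / (1 + (1 - r) / (1 + r))"
    by (simp add: tanh_real_altdef artanh_def)
  also have "\<dots> = (2 * r / (1 + r)) / (2 / (1 + r))"
    using assms by (intro arg_cong2[where f = "(/)"]) (simp_all add: field_simps)
  also have "\<dots> = r"
    using assms by (simp add: abs_less_iff)
  finally show ?thesis .
qed

lemma poincare_dist_Moebius: "poincare_dist a b = artanh (norm (Moebius_function 0 b a))"
  by (simp add: poincare_dist_def Moebius_function_simple)

lemma poincare_dist_nonneg:
  assumes "a \<in> ball 0 1" "b \<in> ball 0 1"
  shows "0 \<le> poincare_dist a b"
  unfolding poincare_dist_Moebius using assms
  by (intro artanh_nonneg Moebius_function_norm_lt_1) auto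

lemma disc_chain_nonneg:
  assumes "disc_chain M l x y"
  shows "0 \<le> l"
  using assms by induction (auto simp: poincare_dist_nonneg)

text \<open>Links the inductive chains with the indexed families over which
  \<open>kobayashi_dist\<close> takes its infimum.\<close>

lemma disc_chain_iff:
  "disc_chain M l z w \<longleftrightarrow>
    (\<exists>(n::nat) p \<phi> a b. l = (\<Sum>j<n. poincare_dist (a j) (b j)) \<and> p 0 = z \<and> p n = w \<and>
      (\<forall>j<n. \<phi> j \<in> holomorphic_discs M \<and> a j \<in> ball 0 1 \<and> b j \<in> ball 0 1 \<and>
             \<phi> j (a j) = p j \<and> \<phi> j (b j) = p (Suc j)))"
    (is "_ \<longleftrightarrow> (\<exists>n p \<phi> a b. ?C n p \<phi> a b l z w)")
proof
  assume "disc_chain M l z w"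
  then show "\<exists>n p \<phi> a b. ?C n p \<phi> a b l z w"
  proof induction
    case (disc_chain_refl x)
    then show ?case
      by (intro exI[of _ 0] exI[of _ "\<lambda>_. x"]) auto
  next
    case (disc_chain_step l x y \<psi> c d w)
    then obtain n p \<phi> a b where C: "?C n p \<phi> a b l x y"
      by blast
    \<comment> \<open>The new disc gets index \<open>n\<close>, the new endpoint index
      \<open>Suc n\<close>; all entries used by the old chain stay as they were.\<close>
    have "?C (Suc n) (p(Suc n := w)) (\<phi>(n := \<psi>)) (a(n := c)) (b(n := d))
        (l + poincare_dist c d) x w"
      using C disc_chain_step.hyps by (auto simp: less_Suc_eq)
    then show ?case by blast
  qed
next
  assume "\<exists>n p \<phi> a b. ?C n p \<phi> a b l z w"
  then obtain n p \<phi> a b where C: "?C n p \<phi> a b l z w"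
    by blast
  have "disc_chain M (\<Sum>j<m. poincare_dist (a j) (b j)) (p 0) (p m)" if "m \<le> n" for m
    using that
  proof (induction m)
    case (Suc m)
    then show ?case
      using C disc_chain_step[of M _ "p 0" "p m" "\<phi> m" "a m" "b m" "p (Suc m)"] by auto
  qed (auto intro: disc_chain_refl)
  from this[of n] show "disc_chain M l z w"
    using C by simp
qed

lemma kobayashi_dist_eq: "kobayashi_dist M z w = Inf {ereal l | l. disc_chain M l z w}"
  unfolding kobayashi_dist_def disc_chain_iff by (rule arg_cong[where f = Inf]) blast

subsection \<open>Geodesics of a single disc\<close>

lemma holomorphic_discs_compose:
  assumes "\<phi> \<in> holomorphic_discs M" "m holomorphic_on ball 0 1" "m ` ball 0 1 \<subseteq> ball 0 1"
  shows "\<phi> \<circ> m \<in> holomorphic_discs M"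
proof -
  have "(\<lambda>\<zeta>. (\<phi> \<circ> m) \<zeta> $ i) holomorphic_on ball 0 1" for i
  proof -
    have "(\<lambda>\<zeta>. \<phi> \<zeta> $ i) holomorphic_on ball 0 1"
      using assms(1) by (simp add: holomorphic_discs_def)
    from holomorphic_on_compose_gen[OF assms(2) this assms(3)] show ?thesis
      by (simp add: o_def)
  qed
  then show ?thesis
    using assms by (auto simp: holomorphic_discs_def image_subset_iff)
qed

lemma disc_deriv_compose:
  assumes "\<phi> \<in> holomorphic_discs M" "(m has_field_derivative D) (at \<zeta>)" "m \<zeta> \<in> ball 0 1"
  shows "disc_deriv (\<phi> \<circ> m) \<zeta> = D *s disc_deriv \<phi> (m \<zeta>)"
proof -
  have "deriv (\<lambda>\<xi>. \<phi> (m \<xi>) $ i) \<zeta> = D * deriv (\<lambda>\<xi>. \<phi> \<xi> $ i) (m \<zeta>)" for i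
  proof -
    have "(\<lambda>\<zeta>. \<phi> \<zeta> $ i) holomorphic_on ball 0 1"
      using assms(1) by (simp add: holomorphic_discs_def)
    then have "((\<lambda>\<xi>. \<phi> \<xi> $ i) has_field_derivative deriv (\<lambda>\<xi>. \<phi> \<xi> $ i) (m \<zeta>)) (at (m \<zeta>))"
      using assms(3) holomorphic_derivI open_ball by blast
    from DERIV_chain2[OF this assms(2)] show ?thesis
      by (simp add: DERIV_imp_deriv)
  qed
  then show ?thesis
    by (simp add: disc_deriv_def vec_eq_iff)
qed

text \<open>Precomposing with the disc automorphism that sends 0 to \<open>x\<close> recentres the
  disc at \<open>\<phi> x\<close> and multiplies its derivative by the derivative of the
  automorphism at 0. The result competes in the infimum with \<open>t = 1\<close>.\<close>

lemma kobayashi_royden_disc_le_1: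
  assumes "\<phi> \<in> holomorphic_discs M" "norm x < 1"
  shows "kobayashi_royden M (\<phi> x) ((1 - (norm x)\<^sup>2) *\<^sub>R disc_deriv \<phi> x) \<le> 1"
proof -
  define m where "m = Moebius_function 0 (- x)"
  have m_hol: "m holomorphic_on ball 0 1" and m_ball: "m ` ball 0 1 \<subseteq> ball 0 1"
    using assms(2) by (auto simp: m_def intro!: Moebius_function_holomorphic Moebius_function_norm_lt_1)
  have m0: "m 0 = x"
    by (simp add: m_def Moebius_function_of_zero)
  \<comment> \<open>Here \<open>m\<close> is the map sending \<open>\<zeta>\<close> to
    \<open>(\<zeta> + x) / (1 + cnj x * \<zeta>)\<close>.\<close>
  have "(m has_field_derivative (1 - x * cnj x)) (at 0)"
    unfolding m_def Moebius_function_simple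
    by (auto intro!: derivative_eq_intros)
  also have "1 - x * cnj x = of_real (1 - (norm x)\<^sup>2)"
    by (metis complex_norm_square of_real_1 of_real_diff)
  finally have "disc_deriv (\<phi> \<circ> m) 0 = of_real (1 - (norm x)\<^sup>2) *s disc_deriv \<phi> x"
    using disc_deriv_compose[OF assms(1)] m0 assms(2) by simp
  also have "\<dots> = (1 - (norm x)\<^sup>2) *\<^sub>R disc_deriv \<phi> x"
    unfolding vec_eq_iff by (simp add: scaleR_conv_of_real[where 'a = complex] algebra_simps)
  finally show ?thesis
    unfolding kobayashi_royden_def
    using holomorphic_discs_compose[OF assms(1) m_hol m_ball] m0
    by (intro Inf_lower) (auto intro!: exI[of _ 1] bexI[of _ "\<phi> \<circ> m"] simp: one_ereal_def)
qed

lemma has_vector_derivative_vec: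
  fixes f :: "real \<Rightarrow> 'a::euclidean_space^'d"
  assumes "\<And>i. ((\<lambda>t. f t $ i) has_vector_derivative (v $ i)) (at x within S)"
  shows "(f has_vector_derivative v) (at x within S)"
  unfolding has_vector_derivative_def has_derivative_componentwise_within[of f]
proof
  fix e :: "'a^'d" assume "e \<in> Basis"
  then obtain i b where e: "e = axis i b"
    by (auto simp: Basis_vec_def)
  show "((\<lambda>t. f t \<bullet> e) has_derivative (\<lambda>h. h *\<^sub>R v \<bullet> e)) (at x within S)"
    using has_derivative_inner_left[OF assms[of i, unfolded has_vector_derivative_def], of b]
    by (simp add: e inner_axis)
qed

text \<open>\<open>tanh\<close> runs along the real diameter at unit Poincare speed: its derivative
  \<open>1 - (tanh t)\<^sup>2\<close> is exactly the factor in
  \<open>kobayashi_royden_disc_le_1\<close>.\<close>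

lemma disc_geodesic_has_vector_derivative:
  assumes "\<phi> \<in> holomorphic_discs M"
  shows "((\<lambda>t. \<phi> (of_real (tanh t))) has_vector_derivative
           ((1 - (tanh t)\<^sup>2) *\<^sub>R disc_deriv \<phi> (of_real (tanh t)))) (at t)"
proof (rule has_vector_derivative_vec)
  fix i
  have t: "complex_of_real (tanh t) \<in> ball 0 1"
    using tanh_real_bounds[of t] by (simp add: abs_less_iff)
  have "(\<lambda>\<zeta>. \<phi> \<zeta> $ i) holomorphic_on ball 0 1"
    using assms by (simp add: holomorphic_discs_def)
  then have 1: "((\<lambda>\<zeta>. \<phi> \<zeta> $ i) has_field_derivative deriv (\<lambda>\<zeta>. \<phi> \<zeta> $ i) (of_real (tanh t)))
      (at (of_real (tanh t)))"
    using t holomorphic_derivI open_ball by blast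
  have "(tanh has_real_derivative (1 - (tanh t)\<^sup>2)) (at t)"
    by (auto intro!: derivative_eq_intros)
  then have 2: "((\<lambda>t. complex_of_real (tanh t)) has_vector_derivative of_real (1 - (tanh t)\<^sup>2)) (at t)"
    by (intro has_vector_derivative_of_real)
  from field_vector_diff_chain_at[OF 2 1]
  show "((\<lambda>t. \<phi> (of_real (tanh t)) $ i) has_vector_derivative
          ((1 - (tanh t)\<^sup>2) *\<^sub>R disc_deriv \<phi> (of_real (tanh t))) $ i) (at t)"
    by (simp add: o_def disc_deriv_def scaleR_conv_of_real[where 'a = complex])
qed

text \<open>A disc need not have bounded derivative near the unit circle, but \<open>tanh\<close>
  maps a compact interval to a compact part of the disc.\<close>

lemma disc_geodesic_lipschitz:
  assumes "\<phi> \<in> holomorphic_discs M"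
  shows "\<exists>C. C-lipschitz_on {a..b} (\<lambda>t. \<phi> (of_real (tanh t)))"
proof -
  define D where "D = (\<lambda>t. (1 - (tanh t)\<^sup>2) *\<^sub>R disc_deriv \<phi> (of_real (tanh t)))"
  have "continuous_on {a..b} (\<lambda>t. deriv (\<lambda>\<zeta>. \<phi> \<zeta> $ i) (of_real (tanh t)))" for i
  proof (rule continuous_on_compose2[where t = "ball 0 1" and g = "deriv (\<lambda>\<zeta>. \<phi> \<zeta> $ i)"])
    show "continuous_on (ball 0 1) (deriv (\<lambda>\<zeta>. \<phi> \<zeta> $ i))"
      using assms by (intro holomorphic_on_imp_continuous_on holomorphic_deriv)
        (auto simp: holomorphic_discs_def)
    show "(\<lambda>t. complex_of_real (tanh t)) ` {a..b} \<subseteq> ball 0 1"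
      using tanh_real_bounds by (auto simp: abs_less_iff)
  qed (auto intro!: continuous_intros)
  then have "continuous_on {a..b} D"
    unfolding D_def disc_deriv_def by (intro continuous_intros) auto
  then have "bounded (D ` {a..b})"
    by (intro compact_imp_bounded compact_continuous_image) auto
  then obtain B where B: "\<And>t. t \<in> {a..b} \<Longrightarrow> norm (D t) \<le> B" and B0: "B > 0"
    unfolding bounded_pos by blast
  have "B-lipschitz_on {a..b} (\<lambda>t. \<phi> (of_real (tanh t)))"
  proof (rule bounded_derivative_imp_lipschitz)
    fix t assume "t \<in> {a..b}"
    show "((\<lambda>t. \<phi> (of_real (tanh t))) has_derivative (\<lambda>h. h *\<^sub>R D t)) (at t within {a..b})"
      using disc_geodesic_has_vector_derivative[OF assms, of t]
      by (auto simp: D_def has_vector_derivative_def intro: has_derivative_at_withinI)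
  next
    fix t assume "t \<in> {a..b}"
    then show "onorm (\<lambda>h. h *\<^sub>R D t) \<le> B"
      using B B0 by (intro onorm_bound) (auto simp: mult.commute[of B] intro!: mult_left_mono)
  qed (use B0 in auto)
  then show ?thesis ..
qed

text \<open>By the addition theorem, the Moebius quotient of \<open>tanh s\<close> and
  \<open>tanh t\<close> is \<open>tanh (s - t)\<close>.\<close>

lemma poincare_dist_tanh:
  "poincare_dist (of_real (tanh s)) (of_real (tanh t)) = \<bar>t - s\<bar>"
proof -
  have "(of_real (tanh s) - of_real (tanh t)) / (1 - cnj (of_real (tanh t)) * of_real (tanh s)) =
      complex_of_real (tanh (s - t))"
    using tanh_add[of s "- t"] by (simp add: mult.commute)
  then have "poincare_dist (of_real (tanh s)) (of_real (tanh t)) = artanh (tanh \<bar>s - t\<bar>)"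
    unfolding poincare_dist_def by (simp only: norm_of_real tanh_real_abs)
  then show ?thesis
    by (simp add: artanh_tanh_real abs_minus_commute del: tanh_real_abs)
qed

text \<open>A disc automorphism moves \<open>a\<close> to 0 and \<open>b\<close> to the positive
  real axis without changing their Poincare distance, so every link of a chain can be followed along
  the real diameter.\<close>

lemma disc_normalize:
  assumes "\<phi> \<in> holomorphic_discs M" "a \<in> ball 0 1" "b \<in> ball 0 1"
  obtains \<psi> where "\<psi> \<in> holomorphic_discs M" "\<psi> 0 = \<phi> a"
    "\<psi> (of_real (tanh (poincare_dist a b))) = \<phi> b"
proof -
  define c where "c = Moebius_function 0 a b"
  define r where "r = norm c"
  have r: "r < 1"
    using assms Moebius_function_norm_lt_1[of a b 0] by (auto simp: r_def c_def)
  \<comment> \<open>The phase of \<open>c\<close>; for \<open>c = 0\<close> any unit number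
    serves.\<close>
  obtain u where u: "norm u = 1" "c = of_real r * u"
  proof (cases "c = 0")
    case True
    then show ?thesis using that[of 1] by (simp add: r_def)
  next
    case False
    then show ?thesis using that[of "c / of_real r"] by (simp add: r_def norm_divide)
  qed
  have "poincare_dist a b = artanh r"
    by (metis poincare_dist_commute poincare_dist_Moebius c_def r_def)
  then have tanh: "tanh (poincare_dist a b) = r"
    using r by (simp add: tanh_artanh r_def)
  define m where "m = Moebius_function 0 (- a) \<circ> (\<lambda>\<zeta>. \<zeta> * u)"
  have u_ball: "(\<lambda>\<zeta>. \<zeta> * u) ` ball 0 1 \<subseteq> ball 0 1"
    by (auto simp: norm_mult u)
  have "m holomorphic_on ball 0 1"
    unfolding m_def using assms u_ball
    by (intro holomorphic_on_compose_gen[where t = "ball 0 1"] Moebius_function_holomorphic holomorphic_intros) auto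
  moreover have "m ` ball 0 1 \<subseteq> ball 0 1"
    using assms by (auto simp: m_def norm_mult u intro!: Moebius_function_norm_lt_1)
  ultimately have "\<phi> \<circ> m \<in> holomorphic_discs M"
    using assms(1) holomorphic_discs_compose by blast
  moreover have "m 0 = a"
    by (simp add: m_def Moebius_function_of_zero)
  moreover have "m (of_real r) = b"
    \<comment> \<open>The rotation takes \<open>r\<close> to \<open>c\<close>, and the Moebius
      functions for \<open>- a\<close> and \<open>a\<close> are inverse to each other.\<close>
    using assms Moebius_function_compose[of "- a" a b] by (simp add: m_def u(2)[symmetric] c_def)
  ultimately show ?thesis
    using that[of "\<phi> \<circ> m"] tanh by simp
qed

subsection \<open>Curves along chains\<close>

text \<open>The properties are those that survive concatenation and yield an almost-geodesic: the
  Lipschitz bound gives absolute continuity, the chains along sub-arcs control distances, and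
  \<open>F\<close> absorbs the corners where discs meet.\<close>

definition chain_curve ::
    "(complex^'d) set \<Rightarrow> real \<Rightarrow> complex^'d \<Rightarrow> complex^'d \<Rightarrow> (real \<Rightarrow> complex^'d) \<Rightarrow> bool" where
  "chain_curve M L x y \<sigma> \<longleftrightarrow>
     0 \<le> L \<and> \<sigma> 0 = x \<and> \<sigma> L = y \<and> \<sigma> ` {0..L} \<subseteq> M \<and> (\<exists>C. C-lipschitz_on {0..L} \<sigma>) \<and>
     (\<forall>s t. 0 \<le> s \<and> s \<le> t \<and> t \<le> L \<longrightarrow> disc_chain M (t - s) (\<sigma> s) (\<sigma> t)) \<and>
     (\<exists>F. finite F \<and> (\<forall>t\<in>{0<..<L} - F.
        \<exists>v. (\<sigma> has_vector_derivative v) (at t) \<and> kobayashi_royden M (\<sigma> t) v \<le> 1))"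

lemma chain_curve_single:
  assumes "\<phi> \<in> holomorphic_discs M" "a \<in> ball 0 1" "b \<in> ball 0 1"
  shows "\<exists>\<sigma>. chain_curve M (poincare_dist a b) (\<phi> a) (\<phi> b) \<sigma>"
proof -
  obtain \<psi> where \<psi>: "\<psi> \<in> holomorphic_discs M" "\<psi> 0 = \<phi> a"
    "\<psi> (of_real (tanh (poincare_dist a b))) = \<phi> b"
    using disc_normalize[OF assms] .
  define \<sigma> where "\<sigma> = (\<lambda>t. \<psi> (of_real (tanh t)))"
  have ball: "complex_of_real (tanh t) \<in> ball 0 1" for t
    using tanh_real_bounds[of t] by (simp add: abs_less_iff)
  have "disc_chain M (t - s) (\<sigma> s) (\<sigma> t)" if "s \<le> t" for s t
    using disc_chain_single[OF \<psi>(1) ball ball, of s t] that by (simp add: \<sigma>_def poincare_dist_tanh)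
  moreover have "\<exists>v. (\<sigma> has_vector_derivative v) (at t) \<and> kobayashi_royden M (\<sigma> t) v \<le> 1" for t
    using disc_geodesic_has_vector_derivative[OF \<psi>(1), of t]
      kobayashi_royden_disc_le_1[OF \<psi>(1), of "of_real (tanh t)"] ball[of t]
    by (auto simp: \<sigma>_def)
  moreover have "\<sigma> ` UNIV \<subseteq> M"
    using \<psi>(1) ball by (auto simp: \<sigma>_def holomorphic_discs_def image_subset_iff)
  ultimately show ?thesis
    using \<psi>(2,3) poincare_dist_nonneg[OF assms(2,3)] disc_geodesic_lipschitz[OF \<psi>(1)]
    unfolding chain_curve_def
    by (intro exI[of _ \<sigma>]) (auto simp: \<sigma>_def)
qed

lemma chain_curve_concat:
  assumes "chain_curve M L1 x y \<sigma>" "chain_curve M L2 y w \<tau>"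
  shows "chain_curve M (L1 + L2) x w (\<lambda>t. if t \<le> L1 then \<sigma> t else \<tau> (t - L1))"
    (is "chain_curve M _ x w ?\<rho>")
proof -
  from assms(1) obtain C F where 1: "0 \<le> L1" "\<sigma> 0 = x" "\<sigma> L1 = y" "\<sigma> ` {0..L1} \<subseteq> M"
    "C-lipschitz_on {0..L1} \<sigma>"
    "\<And>s t. 0 \<le> s \<Longrightarrow> s \<le> t \<Longrightarrow> t \<le> L1 \<Longrightarrow> disc_chain M (t - s) (\<sigma> s) (\<sigma> t)"
    "finite F" "\<And>t. t \<in> {0<..<L1} - F \<Longrightarrow>
        \<exists>v. (\<sigma> has_vector_derivative v) (at t) \<and> kobayashi_royden M (\<sigma> t) v \<le> 1"
    unfolding chain_curve_def by blast
  from assms(2) obtain C' F' where 2: "0 \<le> L2" "\<tau> 0 = y" "\<tau> L2 = w" "\<tau> ` {0..L2} \<subseteq> M"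
    "C'-lipschitz_on {0..L2} \<tau>"
    "\<And>s t. 0 \<le> s \<Longrightarrow> s \<le> t \<Longrightarrow> t \<le> L2 \<Longrightarrow> disc_chain M (t - s) (\<tau> s) (\<tau> t)"
    "finite F'" "\<And>t. t \<in> {0<..<L2} - F' \<Longrightarrow>
        \<exists>v. (\<tau> has_vector_derivative v) (at t) \<and> kobayashi_royden M (\<tau> t) v \<le> 1"
    unfolding chain_curve_def by blast
  \<comment> \<open>Both branches give \<open>y\<close> at the junction, so the second formula holds
    on the closed half-line.\<close>
  have right: "?\<rho> t = \<tau> (t - L1)" if "L1 \<le> t" for t
    using that 1(3) 2(2) by (cases "t = L1") auto
  have "C'-lipschitz_on {L1..L1 + L2} (\<lambda>t. \<tau> (t - L1))"
  proof (rule lipschitz_onI)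
    fix s t assume "s \<in> {L1..L1 + L2}" "t \<in> {L1..L1 + L2}"
    then show "dist (\<tau> (s - L1)) (\<tau> (t - L1)) \<le> C' * dist s t"
      using lipschitz_onD[OF 2(5), of "s - L1" "t - L1"] by (simp add: dist_real_def)
  qed (rule lipschitz_on_nonneg[OF 2(5)])
  then have lip: "(max C C')-lipschitz_on {0..L1 + L2} ?\<rho>"
    using 1(3,5) 2(2) by (intro lipschitz_on_concat_max) auto
  have chain: "disc_chain M (t - s) (?\<rho> s) (?\<rho> t)" if st: "0 \<le> s" "s \<le> t" "t \<le> L1 + L2" for s t
  proof -
    note \<tau>_chain = 2(6)
    consider "t \<le> L1" | "L1 \<le> s" | "s < L1" "L1 < t" by linarith
    then show ?thesis
    proof cases
      case 1
      then show ?thesis using \<open>0 \<le> s\<close> \<open>s \<le> t\<close> assms 1 by (simp add: chain_curve_def)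
    next
      case 2
      then show ?thesis
        using st \<tau>_chain[of "s - L1" "t - L1"] right[of s] right[of t] by simp
    next
      case 3
      \<comment> \<open>An arc across the junction is split at \<open>y\<close>.\<close>
      then have "disc_chain M (L1 - s) (\<sigma> s) y" "disc_chain M (t - L1) y (\<tau> (t - L1))"
        using 1(3) 1(6)[of s L1] 2(2) 2(6)[of 0 "t - L1"] st by auto
      from disc_chain_trans[OF this(2,1)] show ?thesis using 3 by simp
    qed
  qed
  have deriv: "\<exists>v. (?\<rho> has_vector_derivative v) (at t) \<and> kobayashi_royden M (?\<rho> t) v \<le> 1"
    \<comment> \<open>The exceptional times are the old ones, those of \<open>\<tau>\<close> shifted
      by \<open>L1\<close>, and the junction itself.\<close>
    if t: "t \<in> {0<..<L1 + L2} - (F \<union> {L1} \<union> (\<lambda>t. t + L1) ` F')" for t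
  proof (cases "t < L1")
    case True
    then obtain v where v: "(\<sigma> has_vector_derivative v) (at t)" "kobayashi_royden M (\<sigma> t) v \<le> 1"
      using 1(8)[of t] t by auto
    have "(?\<rho> has_vector_derivative v) (at t)"
      by (rule has_vector_derivative_transform_within_open[OF v(1), of "{..<L1}"]) (use True in auto)
    then show ?thesis using v(2) True by auto
  next
    case False
    with t have tL: "t > L1" by auto
    have "t - L1 \<notin> F'" using t by (auto simp: image_iff)
    then obtain v where v: "(\<tau> has_vector_derivative v) (at (t - L1))"
      "kobayashi_royden M (\<tau> (t - L1)) v \<le> 1"
      using 2(8)[of "t - L1"] t tL by auto
    have "((\<tau> \<circ> (\<lambda>t. t - L1)) has_vector_derivative (1 *\<^sub>R v)) (at t)"
      by (rule vector_diff_chain_at) (use v(1) in \<open>auto intro!: derivative_eq_intros\<close>)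
    then have "((\<lambda>t. \<tau> (t - L1)) has_vector_derivative v) (at t)"
      by (simp add: o_def)
    then have "(?\<rho> has_vector_derivative v) (at t)"
      by (rule has_vector_derivative_transform_within_open[of _ _ _ "{L1<..}"]) (use tL in auto)
    then show ?thesis using v(2) tL by auto
  qed
  show ?thesis
    unfolding chain_curve_def
  proof (intro conjI allI impI; (elim conjE)?)
    show "0 \<le> L1 + L2" using 1(1) 2(1) by simp
    show "?\<rho> 0 = x" using 1(1,2) by simp
    show "?\<rho> (L1 + L2) = w" using right[of "L1 + L2"] 2(1,3) by simp
    show "?\<rho> ` {0..L1 + L2} \<subseteq> M" using 1(4) 2(4) by (auto simp: image_subset_iff)
    show "\<exists>C. C-lipschitz_on {0..L1 + L2} ?\<rho>" using lip by (rule exI)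
    show "disc_chain M (t - s) (?\<rho> s) (?\<rho> t)" if "0 \<le> s" "s \<le> t" "t \<le> L1 + L2" for s t
      using that by (rule chain)
    show "\<exists>F. finite F \<and> (\<forall>t\<in>{0<..<L1 + L2} - F.
        \<exists>v. (?\<rho> has_vector_derivative v) (at t) \<and> kobayashi_royden M (?\<rho> t) v \<le> 1)"
      using 1(7) 2(7) deriv by (intro exI[where x = "F \<union> {L1} \<union> (\<lambda>t. t + L1) ` F'"] conjI ballI) simp_all
  qed
qed

text \<open>Each link contributes a single-disc curve, glued on at the end. Membership of
  \<open>x\<close> in \<open>M\<close> is what the empty chain cannot supply.\<close>

lemma disc_chain_imp_chain_curve:
  assumes "disc_chain M L x y" "x \<in> M"
  shows "\<exists>\<sigma>. chain_curve M L x y \<sigma>"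
  using assms
proof induction
  case (disc_chain_refl x)
  have "disc_chain M (t - s) x x" if "0 \<le> s" "s \<le> t" "t \<le> 0" for s t
  proof -
    have "t = s" using that by linarith
    then show ?thesis using disc_chain.disc_chain_refl by simp
  qed
  then have "chain_curve M 0 x x (\<lambda>_. x)"
    unfolding chain_curve_def
    using disc_chain_refl by (auto intro: lipschitz_on_constant)
  then show ?case by (rule exI[where x = "\<lambda>_. x"])
next
  case (disc_chain_step l x y \<phi> a b w)
  then show ?case
    using chain_curve_single chain_curve_concat by metis
qed

subsection \<open>Existence of chains\<close>

text \<open>The restriction of a holomorphic map to a complex line is holomorphic in the line
  parameter, by the chain rule.\<close>

lemma vector_affine_disc_holomorphic:
  fixes \<Psi> :: "complex^'m \<Rightarrow> complex^'n"
  assumes "holomorphic_map_on \<Psi> V" and "\<And>\<zeta>. \<zeta> \<in> S \<Longrightarrow> p + \<zeta> *s v \<in> V" and "open S"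
  shows "(\<lambda>\<zeta>. \<Psi> (p + \<zeta> *s v) $ i) holomorphic_on S"
proof (rule holomorphic_onI)
  fix \<zeta> assume \<zeta>: "\<zeta> \<in> S"
  then obtain f' where f': "(\<Psi> has_derivative f') (at (p + \<zeta> *s v))" "Vector_Spaces.linear (*s) (*s) f'"
    using assms unfolding holomorphic_map_on_def by blast
  interpret f': Vector_Spaces.linear "(*s)" "(*s)" f' by fact
  have "bounded_linear (\<lambda>h::complex. h *s v)"
    by (rule linear_conv_bounded_linear[THEN iffD1])
       (auto intro!: linearI simp: vec_eq_iff algebra_simps)
  then have "((\<lambda>\<zeta>. p + \<zeta> *s v) has_derivative (\<lambda>h. h *s v)) (at \<zeta>)"
    by (auto intro!: derivative_eq_intros dest: bounded_linear_imp_has_derivative)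
  from diff_chain_at[OF this f'(1)]
  have "((\<lambda>\<zeta>. \<Psi> (p + \<zeta> *s v)) has_derivative (\<lambda>h. f' (h *s v))) (at \<zeta>)"
    by (simp add: o_def)
  then have "((\<lambda>\<zeta>. \<Psi> (p + \<zeta> *s v) $ i) has_derivative (\<lambda>h. f' (h *s v) $ i)) (at \<zeta>)"
    by (rule bounded_linear.has_derivative[OF bounded_linear_vec_nth])
  \<comment> \<open>Complex linearity enters here: it turns a real derivative into multiplication by
    a complex number.\<close>
  moreover have "(\<lambda>h. f' (h *s v) $ i) = (*) (f' v $ i)"
    by (simp add: f'.scale fun_eq_iff mult.commute)
  ultimately have "((\<lambda>\<zeta>. \<Psi> (p + \<zeta> *s v) $ i) has_field_derivative (f' v $ i)) (at \<zeta>)"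
    by (simp add: has_field_derivative_def)
  then show "(\<lambda>\<zeta>. \<Psi> (p + \<zeta> *s v) $ i) field_differentiable (at \<zeta> within S)"
    using field_differentiable_at_within field_differentiable_def by blast
qed

text \<open>In a slice chart \<open>M\<close> is a linear coordinate plane, so the complex line
  through \<open>\<Phi> p\<close> and \<open>\<Phi> q\<close> stays in it. Pulling back a piece of
  this line by \<open>\<Psi>\<close> joins \<open>p\<close> to \<open>q\<close> by a single
  disc.\<close>

lemma disc_chain_locally:
  assumes "embedded_complex_submanifold k M" "p \<in> M"
  shows "\<exists>T. openin (top_of_set M) T \<and> p \<in> T \<and> (\<forall>q\<in>T. \<exists>l. disc_chain M l p q)"
proof -
  obtain U V \<Phi> \<Psi> and J :: "'a set" where
    UV: "open U" "open V" "p \<in> U" "homeomorphism U V \<Phi> \<Psi>" "holomorphic_map_on \<Psi> V"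
      and slice: "\<Phi> ` (U \<inter> M) = {y \<in> V. \<forall>i. i \<notin> J \<longrightarrow> y $ i = 0}"
    using assms unfolding embedded_complex_submanifold_def by meson
  have \<Phi>: "continuous_on U \<Phi>" "\<And>x. x \<in> U \<Longrightarrow> \<Phi> x \<in> V" "\<And>x. x \<in> U \<Longrightarrow> \<Psi> (\<Phi> x) = x"
    using UV(4) by (auto simp: homeomorphism_def)
  obtain r where r: "r > 0" "ball (\<Phi> p) r \<subseteq> V"
    using UV(2,3) \<Phi>(2) open_contains_ball by metis
  define W where "W = U \<inter> \<Phi> -` ball (\<Phi> p) r"
  have "open W"
    unfolding W_def using UV(1) \<Phi>(1) by (intro continuous_open_preimage) auto
  then have "openin (top_of_set M) (M \<inter> W)"
    by (rule openin_open_Int)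
  moreover have "p \<in> M \<inter> W"
    using assms(2) UV(3) r by (simp add: W_def)
  moreover have "\<exists>l. disc_chain M l p q" if q: "q \<in> M \<inter> W" for q
  proof (cases "\<Phi> q = \<Phi> p")
    case True
    then have "q = p" using q UV(3) \<Phi>(3) by (metis IntD2 IntD1 W_def)
    then show ?thesis using disc_chain_refl by blast
  next
    case False
    define \<rho> where "\<rho> = norm (\<Phi> q - \<Phi> p)"
    have \<rho>: "0 < \<rho>" "\<rho> < r"
      using False q by (auto simp: \<rho>_def W_def dist_norm norm_minus_commute)
    \<comment> \<open>Scaled to norm \<open>r\<close>, so that the open unit disc fills the line
      inside the ball and \<open>q\<close> is reached at the parameter
      \<open>\<rho> / r < 1\<close>.\<close>
    define v where "v = (r / \<rho>) *\<^sub>R (\<Phi> q - \<Phi> p)"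
    have nv: "norm v = r" using \<rho> r by (simp add: v_def flip: \<rho>_def)
    define \<phi> where "\<phi> = (\<lambda>\<zeta>. \<Psi> (\<Phi> p + \<zeta> *s v))"
    have norm_s: "norm (\<zeta> *s v) = norm \<zeta> * norm v" for \<zeta> :: complex
      by (simp add: norm_vec_def norm_mult L2_set_right_distrib)
    have inV: "\<Phi> p + \<zeta> *s v \<in> V" if "\<zeta> \<in> ball 0 1" for \<zeta>
    proof -
      have "norm (\<zeta> *s v) < r" using that r by (simp add: norm_s nv)
      then have "\<Phi> p + \<zeta> *s v \<in> ball (\<Phi> p) r" by (simp add: dist_norm)
      then show ?thesis using r by blast
    qed
    have plane: "\<Phi> x $ i = 0" if "x \<in> U \<inter> M" "i \<notin> J" for x i
      using slice that by blast
    have "\<phi> \<zeta> \<in> M" if \<zeta>: "\<zeta> \<in> ball 0 1" for \<zeta>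
    proof -
      have "\<Phi> p + \<zeta> *s v \<in> {y \<in> V. \<forall>i. i \<notin> J \<longrightarrow> y $ i = 0}"
        using inV[OF \<zeta>] plane[of p] plane[of q] q assms(2) UV(3) by (auto simp: v_def W_def)
      then have "\<Phi> p + \<zeta> *s v \<in> \<Phi> ` (U \<inter> M)" using slice by simp
      then show ?thesis using \<Phi>(3) by (auto simp: \<phi>_def)
    qed
    moreover have "(\<lambda>\<zeta>. \<phi> \<zeta> $ i) holomorphic_on ball 0 1" for i
      unfolding \<phi>_def by (rule vector_affine_disc_holomorphic[OF UV(5) inV]) auto
    ultimately have disc: "\<phi> \<in> holomorphic_discs M"
      by (auto simp: holomorphic_discs_def)
    have "of_real (\<rho> / r) *s v = (\<rho> / r) *\<^sub>R v"
      unfolding vec_eq_iff by (simp add: scaleR_conv_of_real[where 'a = complex])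
    also have "\<dots> = \<Phi> q - \<Phi> p" using \<rho> r by (simp add: v_def)
    finally have "\<phi> (of_real (\<rho> / r)) = q"
      using q \<Phi>(3) by (simp add: \<phi>_def W_def)
    moreover have "\<phi> 0 = p" using UV(3) \<Phi>(3) by (simp add: \<phi>_def)
    moreover have "complex_of_real (\<rho> / r) \<in> ball 0 1" using \<rho> r by (simp add: norm_divide)
    ultimately show ?thesis
      using disc_chain_single[OF disc, of 0 "of_real (\<rho> / r)"] by auto
  qed
  ultimately show ?thesis by blast
qed

text \<open>Being joined by a chain is an equivalence relation with relatively open classes, so a
  connected \<open>M\<close> is a single class.\<close>

lemma disc_chain_exists:
  assumes "embedded_complex_submanifold k M" "connected M" "z \<in> M" "w \<in> M"
  shows "\<exists>l. disc_chain M l z w"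
  using assms(2-4)
proof (rule connected_equivalence_relation)
  show "\<exists>l. disc_chain M l y x" if "\<exists>l. disc_chain M l x y" for x y
    using that disc_chain_sym by blast
  show "\<exists>l. disc_chain M l x v" if "\<exists>l. disc_chain M l x y" "\<exists>l. disc_chain M l y v" for x y v
    using that disc_chain_trans by blast
qed (rule disc_chain_locally[OF assms(1)])

subsection \<open>Almost-geodesics\<close>

lemma lipschitz_on_imp_absolutely_continuous_curve:
  assumes "C-lipschitz_on I \<sigma>"
  shows "absolutely_continuous_curve I \<sigma>"
  unfolding absolutely_continuous_curve_def
proof (intro allI impI)
  fix \<epsilon> :: real assume \<epsilon>: "\<epsilon> > 0"
  have C: "0 \<le> C" using assms by (rule lipschitz_on_nonneg)
  show "\<exists>\<delta>>0. \<forall>(n::nat) s t. (\<forall>j<n. s j \<le> t j \<and> {s j..t j} \<subseteq> I) \<and>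
        disjoint_family_on (\<lambda>j. {s j<..<t j}) {..<n} \<and> (\<Sum>j<n. t j - s j) < \<delta>
        \<longrightarrow> (\<Sum>j<n. norm (\<sigma> (t j) - \<sigma> (s j))) < \<epsilon>"
  \<comment> \<open>Adding 1 keeps the denominator positive when \<open>C = 0\<close>.\<close>
  proof (intro exI[of _ "\<epsilon> / (C + 1)"] conjI allI impI; (elim conjE)?)
    show "0 < \<epsilon> / (C + 1)" using \<epsilon> C by simp
    fix n :: nat and s t
    assume st: "\<forall>j<n. s j \<le> t j \<and> {s j..t j} \<subseteq> I" and sum: "(\<Sum>j<n. t j - s j) < \<epsilon> / (C + 1)"
    have "(\<Sum>j<n. norm (\<sigma> (t j) - \<sigma> (s j))) \<le> (\<Sum>j<n. C * (t j - s j))"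
    proof (rule sum_mono)
      fix j assume "j \<in> {..<n}"
      then have "s j \<le> t j" "{s j..t j} \<subseteq> I" using st by auto
      then show "norm (\<sigma> (t j) - \<sigma> (s j)) \<le> C * (t j - s j)"
        using lipschitz_on_normD[OF assms, of "t j" "s j"] by (auto simp: subset_iff)
    qed
    also have "\<dots> = C * (\<Sum>j<n. t j - s j)" by (simp add: sum_distrib_left)
    also have "\<dots> \<le> (C + 1) * (\<Sum>j<n. t j - s j)"
      using st by (intro mult_right_mono sum_nonneg) auto
    also have "\<dots> < \<epsilon>" using sum C by (simp add: field_simps)
    finally show "(\<Sum>j<n. norm (\<sigma> (t j) - \<sigma> (s j))) < \<epsilon>" .
  qed
qed

lemma AE_lebesgue_off_finite:
  fixes F :: "real set"
  assumes "finite F" "\<And>t. t \<notin> F \<Longrightarrow> P t"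
  shows "AE t in lebesgue. P t"
proof (rule AE_I')
  show "F \<in> null_sets lebesgue"
    using assms(1) by (simp add: negligible_iff_null_sets[symmetric] negligible_finite)
  show "{t \<in> space lebesgue. \<not> P t} \<subseteq> F"
    using assms(2) by auto
qed

lemma almost_geodesicI:
  assumes curve: "chain_curve M L z w \<sigma>" and L: "0 < L"
    and min: "\<And>l. disc_chain M l z w \<Longrightarrow> L - \<kappa> \<le> l" and \<kappa>: "0 < \<kappa>"
  shows "almost_geodesic M \<kappa> {0..L} \<sigma>"
proof -
  from curve obtain C F where \<sigma>: "\<sigma> 0 = z" "\<sigma> L = w" "\<sigma> ` {0..L} \<subseteq> M" "C-lipschitz_on {0..L} \<sigma>"
    "\<And>s t. 0 \<le> s \<Longrightarrow> s \<le> t \<Longrightarrow> t \<le> L \<Longrightarrow> disc_chain M (t - s) (\<sigma> s) (\<sigma> t)"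
    "finite F" "\<And>t. t \<in> {0<..<L} - F \<Longrightarrow>
        \<exists>v. (\<sigma> has_vector_derivative v) (at t) \<and> kobayashi_royden M (\<sigma> t) v \<le> 1"
    unfolding chain_curve_def by blast
  have chain: "disc_chain M \<bar>t - s\<bar> (\<sigma> t) (\<sigma> s)" if "s \<in> {0..L}" "t \<in> {0..L}" for s t
    using that \<sigma>(5)[of s t] \<sigma>(5)[of t s] disc_chain_sym by (cases "s \<le> t") auto
  have "kobayashi_dist M (\<sigma> t) (\<sigma> s) \<le> ereal (\<bar>t - s\<bar> + \<kappa>)"
    if "s \<in> {0..L}" "t \<in> {0..L}" for s t
  proof -
    \<comment> \<open>The arc itself is a competing chain; the slack \<open>\<kappa>\<close> is
      really spent on the lower bound.\<close>
    have "kobayashi_dist M (\<sigma> t) (\<sigma> s) \<le> ereal \<bar>t - s\<bar>"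
      unfolding kobayashi_dist_eq using chain[OF that] by (intro Inf_lower) blast
    also have "\<dots> \<le> ereal (\<bar>t - s\<bar> + \<kappa>)" using \<kappa> by simp
    finally show ?thesis .
  qed
  \<comment> \<open>A chain from \<open>\<sigma> s\<close> to \<open>\<sigma> t\<close> is completed
    to one from \<open>z\<close> to \<open>w\<close> by the initial arc of length \<open>s\<close>
    and the final arc of length \<open>L - t\<close>. No order of \<open>s\<close> and
    \<open>t\<close> is assumed, so applying this both ways produces the absolute value.\<close>
  moreover have lower: "t - s - \<kappa> \<le> l" if "s \<in> {0..L}" "t \<in> {0..L}" "disc_chain M l (\<sigma> s) (\<sigma> t)" for s t l
  proof -
    have "disc_chain M s z (\<sigma> s)" "disc_chain M (L - t) (\<sigma> t) w"
      using \<sigma>(5)[of 0 s] \<sigma>(5)[of t L] \<sigma>(1,2) that by auto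
    then have "disc_chain M (s + l + (L - t)) z w"
      using that disc_chain_trans by blast
    from min[OF this] show ?thesis by simp
  qed
  have "ereal (\<bar>t - s\<bar> - \<kappa>) \<le> kobayashi_dist M (\<sigma> t) (\<sigma> s)"
    if st: "s \<in> {0..L}" "t \<in> {0..L}" for s t
    unfolding kobayashi_dist_eq
  proof (rule Inf_greatest, clarsimp)
    fix l assume l: "disc_chain M l (\<sigma> t) (\<sigma> s)"
    show "\<bar>t - s\<bar> - \<kappa> \<le> l"
      using lower[OF st disc_chain_sym[OF l]] lower[OF st(2,1) l] by linarith
  qed
  moreover have "AE t in lebesgue. t \<in> {0..L} \<longrightarrow> \<sigma> differentiable (at t within {0..L}) \<and>
        kobayashi_royden M (\<sigma> t) (vector_derivative \<sigma> (at t within {0..L})) \<le> 1"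
  \<comment> \<open>Discarding the endpoints leaves interior times, where the derivative within the
    interval is the two-sided one.\<close>
  proof (rule AE_lebesgue_off_finite[of "F \<union> {0, L}"], goal_cases)
    case 1
    show ?case using \<sigma>(6) by simp
  next
    case (2 t)
    show ?case
    proof
      assume t: "t \<in> {0..L}"
      with 2 obtain v where v: "(\<sigma> has_vector_derivative v) (at t)" "kobayashi_royden M (\<sigma> t) v \<le> 1"
        using \<sigma>(7)[of t] by force
      then show "\<sigma> differentiable (at t within {0..L}) \<and>
          kobayashi_royden M (\<sigma> t) (vector_derivative \<sigma> (at t within {0..L})) \<le> 1"
        using vector_derivative_at_within_ivl[OF v(1), of 0 L] t L
          differentiableI_vector[OF v(1)] differentiable_at_withinI by auto
    qed
  qed
  ultimately show ?thesis
    unfolding almost_geodesic_def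
    using \<sigma>(3) lipschitz_on_imp_absolutely_continuous_curve[OF \<sigma>(4)] by (auto simp: is_interval_cc)
qed

text \<open>Supplies a nondegenerate interval when the chosen chain has length 0. On an interval of
  length \<open>\<kappa>\<close> the lower bound \<open>\<bar>t - s\<bar> - \<kappa>\<close> is at
  most 0, so standing still is allowed.\<close>

lemma almost_geodesic_const:
  assumes "z \<in> M" "0 < \<kappa>"
  shows "almost_geodesic M \<kappa> {0..\<kappa>} (\<lambda>_. z)"
proof -
  have disc: "(\<lambda>_. z) \<in> holomorphic_discs M"
    using assms(1) by (auto simp: holomorphic_discs_def)
  have "ereal 1 \<in> {ereal t | t. 0 < t \<and> (\<exists>\<phi>\<in>holomorphic_discs M. \<phi> 0 = z \<and> t *\<^sub>R disc_deriv \<phi> 0 = 0)}"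
    using disc by (auto intro!: bexI[of _ "\<lambda>_. z"] simp: disc_deriv_def vec_eq_iff)
  then have "kobayashi_royden M z 0 \<le> 1"
    unfolding kobayashi_royden_def one_ereal_def by (rule Inf_lower)
  moreover have "kobayashi_dist M z z = 0"
    unfolding kobayashi_dist_eq
    by (intro antisym Inf_lower Inf_greatest)
      (auto simp: zero_ereal_def intro: disc_chain_refl disc_chain_nonneg)
  moreover have "absolutely_continuous_curve {0..\<kappa>} (\<lambda>_. z)"
    using lipschitz_on_constant by (rule lipschitz_on_imp_absolutely_continuous_curve)
  moreover have "vector_derivative (\<lambda>_. z) (at t within {0..\<kappa>}) = 0" if "t \<in> {0..\<kappa>}" for t
    using that assms by (intro vector_derivative_at_within_ivl) auto
  ultimately show ?thesis
    unfolding almost_geodesic_def using assms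
    by (auto simp: is_interval_cc zero_ereal_def)
qed

theorem theorem2p8:
  fixes M :: "(complex^'d) set" and k :: nat and z w :: "complex^'d" and \<kappa> :: real
  assumes "embedded_complex_submanifold k M"
    and "bounded M"
    and "connected M"
    and "z \<in> M" and "w \<in> M"
    and "\<kappa> > 0"
  shows "\<exists>a b \<sigma>. a < b \<and> almost_geodesic M \<kappa> {a..b} \<sigma> \<and> \<sigma> a = z \<and> \<sigma> b = w"
proof -
  \<comment> \<open>The infimum is taken over real lengths: \<open>S\<close> is nonempty by
    connectedness and bounded below by 0, so a length within \<open>\<kappa>\<close> of it
    exists.\<close>
  define S where "S = {l. disc_chain M l z w}"
  have "S \<noteq> {}"
    using disc_chain_exists[OF assms(1,3-5)] by (auto simp: S_def)
  moreover have bdd: "bdd_below S"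
    by (auto simp: S_def intro!: bdd_belowI disc_chain_nonneg)
  ultimately obtain L where L: "disc_chain M L z w" "L < Inf S + \<kappa>"
    using cInf_lessD[of S "Inf S + \<kappa>"] assms(6) by (auto simp: S_def)
  have min: "L - \<kappa> \<le> l" if "disc_chain M l z w" for l
    using cInf_lower[OF _ bdd, of l] that L(2) by (auto simp: S_def)
  obtain \<sigma> where \<sigma>: "chain_curve M L z w \<sigma>"
    using disc_chain_imp_chain_curve[OF L(1) assms(4)] ..
  show ?thesis
  proof (cases "L = 0")
    case True
    \<comment> \<open>The two ends of the curve are its values at 0 and at \<open>L\<close>, which
      coincide here.\<close>
    then have "z = w" using \<sigma> by (auto simp: chain_curve_def)
    then show ?thesis
      using almost_geodesic_const[OF assms(4,6)] assms(6) by blast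
  next
    case False
    then have "0 < L" using disc_chain_nonneg[OF L(1)] by simp
    then show ?thesis
      using almost_geodesicI[OF \<sigma> _ min assms(6)] \<sigma> by (auto simp: chain_curve_def)
  qed
qed

end
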